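(* Let $I$ be an image, let $p\in\mathbb{R}^2$ be a point, and let $h\in G$. Let $f:G\to\mathbb{R}^{n_0}$ be the group feature of $p$ in $I$, that is, $f(g)=\phi(\eta(T_g\circ I),T_g(p))$ for $g\in G$. Let $f':G\to\mathbb{R}^{n_0}$ be the group feature of the corresponding point $T_h(p)$ in the transformed image $T_h\circ I$, that is, $f'(g)=\phi(\eta(T_g\circ T_h\circ I),T_g(T_h(p)))$ for $g\in G$. Then for every $g\in G$, $$f'(g)=\phi(\eta(T_{gh}\circ I),T_{gh}(p))=f(gh).$$
   Context: $G$ is the group of planar transformations generated by rotations about a fixed origin and (positive, uniform) scalings about that origin; it is a subgroup of the affine group of the plane, with composition as group law. For $g\in G$, $T_g:\mathbb{R}^2\to\mathbb{R}^2$ denotes the corresponding transformation of the plane, so $T_g\circ T_h=T_{gh}$ on points. An image is a function $I:\mathbb{R}^2\to\mathbb{R}^c$ (for a fixed number $c$ of channels), and $T_g\circ I$ denotes the transformed (warped) image, given by $(T_g\circ I)(x)=I(T_g^{-1}(x))$. $\eta$ is a fixed map (computed by a convolutional neural network, treated as an arbitrary function) sending each image to a feature map $\mathbb{Z}^2\to\mathbb{R}^{n_0}$. For a feature map $F:\mathbb{Z}^2\to\mathbb{R}^{n_0}$ and a point $q\in\mathbb{R}^2$, $\phi(F,q)\in\mathbb{R}^{n_0}$ is the value at $q$ of the bilinear interpolation of $F$. A group feature is a map $G\to\mathbb{R}^n$. The group feature of a point $p$ in an image $I$ is the map $g\mapsto\phi(\eta(T_g\circ I),T_g(p))$. *)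

theory Defs
  imports "HOL-Analysis.Analysis" "HOL-Algebra.Generated_Groups"
begin

type_synonym plane = "real ^ 2"

definition affine_group :: "(plane \<Rightarrow> plane) monoid" where
  "affine_group =
    \<lparr>carrier = {f. \<exists>A b. invertible A \<and> f = (\<lambda>x. A *v x + b)}, mult = (\<circ>), one = id\<rparr>"

definition rotations_about :: "plane \<Rightarrow> (plane \<Rightarrow> plane) set" where
  "rotations_about c = {\<lambda>x. c + A *v (x - c) | A. rotation_matrix A}"

definition scalings_about :: "plane \<Rightarrow> (plane \<Rightarrow> plane) set" where
  "scalings_about c = {\<lambda>x. c + s *\<^sub>R (x - c) | s. s > 0}"

(* The elements of this group are the transformations themselves, so T_g is g. *)
definition rot_scale_group :: "plane \<Rightarrow> (plane \<Rightarrow> plane) monoid" where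
  "rot_scale_group c =
    affine_group\<lparr>carrier := generate affine_group (rotations_about c \<union> scalings_about c)\<rparr>"

definition warp :: "(plane \<Rightarrow> plane) \<Rightarrow> (plane \<Rightarrow> real ^ 'c) \<Rightarrow> plane \<Rightarrow> real ^ 'c" where
  "warp g I = (\<lambda>x. I (inv_into UNIV g x))"

definition bilinear_interp :: "(int \<times> int \<Rightarrow> real ^ 'n) \<Rightarrow> plane \<Rightarrow> real ^ 'n" where
  "bilinear_interp F q =
    (let i = \<lfloor>q $ 1\<rfloor>; j = \<lfloor>q $ 2\<rfloor>; s = frac (q $ 1); t = frac (q $ 2) in
       ((1 - s) * (1 - t)) *\<^sub>R F (i, j) + (s * (1 - t)) *\<^sub>R F (i + 1, j)
       + ((1 - s) * t) *\<^sub>R F (i, j + 1) + (s * t) *\<^sub>R F (i + 1, j + 1))"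

(* A map with domain the group: extensional, i.e. undefined outside the carrier. *)
definition group_feature ::
  "plane \<Rightarrow> ((plane \<Rightarrow> real ^ 'c) \<Rightarrow> int \<times> int \<Rightarrow> real ^ 'n) \<Rightarrow>
    (plane \<Rightarrow> real ^ 'c) \<Rightarrow> plane \<Rightarrow> (plane \<Rightarrow> plane) \<Rightarrow> real ^ 'n" where
  "group_feature c \<eta> I p =
    (\<lambda>g\<in>carrier (rot_scale_group c). bilinear_interp (\<eta> (warp g I)) (g p))"

lemma affine_groupI:
  "invertible A \<Longrightarrow> f = (\<lambda>x. A *v x + b) \<Longrightarrow> f \<in> carrier affine_group"
  by (auto simp: affine_group_def)

lemma group_affine_group: "group affine_group"
proof (rule groupI)
  fix f g assume "f \<in> carrier affine_group" "g \<in> carrier affine_group"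
  then obtain A b B d where *: "invertible A" "f = (\<lambda>x. A *v x + b)"
      "invertible B" "g = (\<lambda>x. B *v x + d)"
    by (auto simp: affine_group_def)
  have "f \<circ> g = (\<lambda>x. (A ** B) *v x + (A *v d + b))"
    by (simp add: * fun_eq_iff matrix_vector_right_distrib matrix_vector_mul_assoc add.assoc)
  then show "f \<otimes>\<^bsub>affine_group\<^esub> g \<in> carrier affine_group"
    using affine_groupI[OF invertible_mult[OF *(1,3)]] by (simp add: affine_group_def)
next
  have "invertible (mat 1 :: real^2^2)" by (simp add: invertible_det_nz)
  moreover have "\<one>\<^bsub>affine_group\<^esub> = (\<lambda>x. mat 1 *v x + 0)"
    by (simp add: affine_group_def fun_eq_iff)
  ultimately show "\<one>\<^bsub>affine_group\<^esub> \<in> carrier affine_group" by (rule affine_groupI)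
next
  fix f assume "f \<in> carrier affine_group"
  then obtain A b where *: "invertible A" "f = (\<lambda>x. A *v x + b)"
    by (auto simp: affine_group_def)
  obtain B where B: "A ** B = mat 1" "B ** A = mat 1" using *(1) by (auto simp: invertible_def)
  define g where "g = (\<lambda>x. B *v x + - (B *v b))"
  have "invertible B" using B by (auto simp: invertible_def)
  then have "g \<in> carrier affine_group" by (rule affine_groupI) (rule g_def)
  moreover have "g \<circ> f = id"
    by (simp add: g_def * fun_eq_iff matrix_vector_right_distrib matrix_vector_mul_assoc B)
  ultimately show "\<exists>g\<in>carrier affine_group. g \<otimes>\<^bsub>affine_group\<^esub> f = \<one>\<^bsub>affine_group\<^esub>"
    by (auto simp: affine_group_def)
qed (auto simp: affine_group_def)

lemma rotations_about_subset: "rotations_about c \<subseteq> carrier affine_group"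
proof
  fix f assume "f \<in> rotations_about c"
  then obtain A where A: "rotation_matrix A" "f = (\<lambda>x. c + A *v (x - c))"
    by (auto simp: rotations_about_def)
  have "invertible A" using A by (simp add: rotation_matrix_def invertible_det_nz)
  moreover have "f = (\<lambda>x. A *v x + (c - A *v c))"
    by (simp add: A fun_eq_iff matrix_vector_mult_diff_distrib)
  ultimately show "f \<in> carrier affine_group" by (rule affine_groupI)
qed

lemma scalings_about_subset: "scalings_about c \<subseteq> carrier affine_group"
proof
  fix f assume "f \<in> scalings_about c"
  then obtain s where s: "s > 0" "f = (\<lambda>x. c + s *\<^sub>R (x - c))"
    by (auto simp: scalings_about_def)
  have "invertible (mat s :: real^2^2)" using s by (simp add: invertible_det_nz det_2 mat_def)
  moreover have "f = (\<lambda>x. mat s *v x + (c - s *\<^sub>R c))"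
    by (simp add: s fun_eq_iff vec_eq_iff mat_def matrix_vector_mult_def forall_2 sum_2 algebra_simps)
  ultimately show "f \<in> carrier affine_group" by (rule affine_groupI)
qed

lemma subgroup_rot_scale_group: "subgroup (carrier (rot_scale_group c)) affine_group"
  using group.generate_is_subgroup[OF group_affine_group, of "rotations_about c \<union> scalings_about c"]
    rotations_about_subset scalings_about_subset
  by (simp add: rot_scale_group_def)

lemma group_rot_scale_group: "group (rot_scale_group c)"
  using group.subgroup_imp_group[OF group_affine_group subgroup_rot_scale_group[of c]]
  by (simp add: rot_scale_group_def)

end

theory Submission
  imports Defs
begin

text \<open>Warping is a left action: since the inverse of \<open>g \<circ> h\<close> is the inverse
  of \<open>h\<close> after that of \<open>g\<close>, warping by \<open>h\<close> and then by
  \<open>g\<close> is warping by \<open>g \<circ> h\<close> (\<open>warp_comp\<close>). Points move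
  by the same composite, so \<open>f'\<close> at \<open>g\<close> and \<open>f\<close> at the
  product interpolate the same feature map at the same point, whatever \<open>\<eta>\<close>
  is.\<close>

lemma bij_affine_group:
  assumes "f \<in> carrier affine_group"
  shows "bij f"
\<comment> \<open>The group law is composition and the unit is \<open>id\<close>, so the group
  inverse is a two-sided inverse function.\<close>
proof (rule o_bij)
  interpret group affine_group by (rule group_affine_group)
  show "inv\<^bsub>affine_group\<^esub> f \<circ> f = id"
    using l_inv[OF assms] by (simp add: affine_group_def)
  show "f \<circ> inv\<^bsub>affine_group\<^esub> f = id"
    using r_inv[OF assms] by (simp add: affine_group_def)
qed

lemma bij_rot_scale_group:
  "f \<in> carrier (rot_scale_group c) \<Longrightarrow> bij f"
  using bij_affine_group subgroup.subset[OF subgroup_rot_scale_group] by blast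

lemma mult_rot_scale_group [simp]: "g \<otimes>\<^bsub>rot_scale_group c\<^esub> h = g \<circ> h"
  by (simp add: rot_scale_group_def affine_group_def)

text \<open>Bijectivity makes \<open>inv_into UNIV\<close> a genuine inverse, which reverses
  composites; precomposing with it restores the order.\<close>

lemma warp_comp:
  assumes "bij g" "bij h"
  shows "warp (g \<circ> h) I = warp g (warp h I)"
  using assms by (simp add: warp_def o_inv_distrib)

theorem lemma1:
  fixes c :: plane
    and \<eta> :: "(plane \<Rightarrow> real ^ 'c) \<Rightarrow> int \<times> int \<Rightarrow> real ^ 'n"
    and I :: "plane \<Rightarrow> real ^ 'c"
    and p :: plane
    and h :: "plane \<Rightarrow> plane"
    and f f' :: "(plane \<Rightarrow> plane) \<Rightarrow> real ^ 'n"
  assumes "h \<in> carrier (rot_scale_group c)"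
    and "f = group_feature c \<eta> I p"
    and "f' = group_feature c \<eta> (warp h I) (h p)"
  shows "\<forall>g \<in> carrier (rot_scale_group c).
    f' g = bilinear_interp (\<eta> (warp (g \<otimes>\<^bsub>rot_scale_group c\<^esub> h) I)) ((g \<otimes>\<^bsub>rot_scale_group c\<^esub> h) p) \<and>
    bilinear_interp (\<eta> (warp (g \<otimes>\<^bsub>rot_scale_group c\<^esub> h) I)) ((g \<otimes>\<^bsub>rot_scale_group c\<^esub> h) p)
      = f (g \<otimes>\<^bsub>rot_scale_group c\<^esub> h)"
proof (rule ballI, rule conjI)
  fix g assume g: "g \<in> carrier (rot_scale_group c)"
  show "f' g = bilinear_interp (\<eta> (warp (g \<otimes>\<^bsub>rot_scale_group c\<^esub> h) I)) ((g \<otimes>\<^bsub>rot_scale_group c\<^esub> h) p)"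
    using g assms bij_rot_scale_group by (simp add: group_feature_def warp_comp)
  \<comment> \<open>A group feature is \<open>undefined\<close> off the carrier, so closure is what
    lets \<open>f\<close> be unfolded at the product.\<close>
  have "g \<otimes>\<^bsub>rot_scale_group c\<^esub> h \<in> carrier (rot_scale_group c)"
    using group_rot_scale_group g assms(1) by (intro monoid.m_closed group.is_monoid)
  then show "bilinear_interp (\<eta> (warp (g \<otimes>\<^bsub>rot_scale_group c\<^esub> h) I)) ((g \<otimes>\<^bsub>rot_scale_group c\<^esub> h) p)
      = f (g \<otimes>\<^bsub>rot_scale_group c\<^esub> h)"
    using assms(2) by (simp add: group_feature_def)
qed

end
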